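(* Let $X$ be a small category and $P$ a category over $X$. The fibers over $x\in X$ of the coreflections $P{\downarrow}$ and $P{\uparrow}$ of $P$ in discrete fibrations and in discrete opfibrations, respectively, have the form $$(P{\downarrow})x\cong\hom({\downarrow}x,P),\qquad (P{\uparrow})x\cong\hom({\uparrow}x,P).$$
   Context: $\mathbf{Cat}/X$ is the slice category: objects ("categories over $X$") are functors $\pi:P\to X$ with $P$ small (denoted simply $P$), morphisms are functors commuting with the projections to $X$; $\hom(P,Q)$ is the set of morphisms $P\to Q$ in $\mathbf{Cat}/X$. $P$ is a discrete fibration if for every object $a$ of $P$ and every arrow $f:y\to\pi a$ of $X$ there is a unique arrow of $P$ with codomain $a$ lying over $f$; a discrete opfibration is defined dually. $\overleftarrow{X}$ and $\overrightarrow{X}$ denote the full subcategories of $\mathbf{Cat}/X$ given by discrete fibrations and discrete opfibrations. The inclusion $\overleftarrow{X}\hookrightarrow\mathbf{Cat}/X$ has a left adjoint ${\downarrow}(-)$ and a right adjoint $(-){\downarrow}$, and the inclusion $\overrightarrow{X}\hookrightarrow\mathbf{Cat}/X$ has a left adjoint ${\uparrow}(-)$ and a right adjoint $(-){\uparrow}$. An object $x$ of $X$ is regarded as the category $x:\mathbf{1}\to X$ over $X$; its reflections are the slices ${\downarrow}x\cong X/x$ and ${\uparrow}x\cong x/X$, with their canonical projections to $X$. For a discrete (op)fibration $A$, $Ax$ is the set of objects of $A$ over $x$. *)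

theory Defs
  imports "HOL-Library.FuncSet"
begin

record ('o, 'a) cat =
  Obj :: "'o set"
  Arr :: "'a set"
  Dom :: "'a \<Rightarrow> 'o"
  Cod :: "'a \<Rightarrow> 'o"
  Ide :: "'o \<Rightarrow> 'a"
  Comp :: "'a \<Rightarrow> 'a \<Rightarrow> 'a"

(* Comp C g f is "g after f"; it is meaningful only if Dom C g = Cod C f. *)
locale category =
  fixes C :: "('o, 'a, 'm) cat_scheme"
  assumes Dom_closed: "f \<in> Arr C \<Longrightarrow> Dom C f \<in> Obj C"
    and Cod_closed: "f \<in> Arr C \<Longrightarrow> Cod C f \<in> Obj C"
    and Ide_closed: "x \<in> Obj C \<Longrightarrow> Ide C x \<in> Arr C"
    and Dom_Ide: "x \<in> Obj C \<Longrightarrow> Dom C (Ide C x) = x"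
    and Cod_Ide: "x \<in> Obj C \<Longrightarrow> Cod C (Ide C x) = x"
    and Comp_closed:
      "\<lbrakk>f \<in> Arr C; g \<in> Arr C; Dom C g = Cod C f\<rbrakk> \<Longrightarrow> Comp C g f \<in> Arr C"
    and Dom_Comp:
      "\<lbrakk>f \<in> Arr C; g \<in> Arr C; Dom C g = Cod C f\<rbrakk> \<Longrightarrow> Dom C (Comp C g f) = Dom C f"
    and Cod_Comp:
      "\<lbrakk>f \<in> Arr C; g \<in> Arr C; Dom C g = Cod C f\<rbrakk> \<Longrightarrow> Cod C (Comp C g f) = Cod C g"
    and Comp_Ide: "f \<in> Arr C \<Longrightarrow> Comp C f (Ide C (Dom C f)) = f"
    and Ide_Comp: "f \<in> Arr C \<Longrightarrow> Comp C (Ide C (Cod C f)) f = f"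
    and Comp_assoc:
      "\<lbrakk>f \<in> Arr C; g \<in> Arr C; h \<in> Arr C; Dom C g = Cod C f; Dom C h = Cod C g\<rbrakk>
        \<Longrightarrow> Comp C h (Comp C g f) = Comp C (Comp C h g) f"

locale is_functor = A: category A + B: category B
  for A :: "('o, 'a, 'm) cat_scheme" and B :: "('p, 'b, 'n) cat_scheme" +
  fixes Fo :: "'o \<Rightarrow> 'p" and Fa :: "'a \<Rightarrow> 'b"
  assumes map_Obj: "a \<in> Obj A \<Longrightarrow> Fo a \<in> Obj B"
    and map_Arr: "f \<in> Arr A \<Longrightarrow> Fa f \<in> Arr B"
    and map_Dom: "f \<in> Arr A \<Longrightarrow> Dom B (Fa f) = Fo (Dom A f)"
    and map_Cod: "f \<in> Arr A \<Longrightarrow> Cod B (Fa f) = Fo (Cod A f)"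
    and map_Ide: "a \<in> Obj A \<Longrightarrow> Fa (Ide A a) = Ide B (Fo a)"
    and map_Comp:
      "\<lbrakk>f \<in> Arr A; g \<in> Arr A; Dom A g = Cod A f\<rbrakk>
        \<Longrightarrow> Fa (Comp A g f) = Comp B (Fa g) (Fa f)"

record ('o, 'a, 'x, 'y) cat_over = "('o, 'a) cat" +
  prO :: "'o \<Rightarrow> 'x"
  prA :: "'a \<Rightarrow> 'y"

definition category_over ::
  "('x, 'y) cat \<Rightarrow> ('o, 'a, 'x, 'y) cat_over \<Rightarrow> bool" where
  "category_over X P \<longleftrightarrow> is_functor P X (prO P) (prA P)"

type_synonym ('o, 'a, 'p, 'b) fmap = "('o \<Rightarrow> 'p) \<times> ('a \<Rightarrow> 'b)"

(* The maps are required to be extensional so that distinct elements of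
   over_hom P Q are distinct functors. *)
definition over_hom ::
  "('o, 'a, 'x, 'y) cat_over \<Rightarrow> ('p, 'b, 'x, 'y) cat_over
    \<Rightarrow> ('o, 'a, 'p, 'b) fmap set" where
  "over_hom P Q = {(Fo, Fa).
     is_functor P Q Fo Fa \<and> Fo \<in> extensional (Obj P) \<and> Fa \<in> extensional (Arr P) \<and>
     (\<forall>a\<in>Obj P. prO Q (Fo a) = prO P a) \<and> (\<forall>f\<in>Arr P. prA Q (Fa f) = prA P f)}"

definition fmap_comp ::
  "('o, 'a, 'm) cat_scheme \<Rightarrow> ('p, 'b, 'q, 'c) fmap \<Rightarrow> ('o, 'a, 'p, 'b) fmap
    \<Rightarrow> ('o, 'a, 'q, 'c) fmap" where
  "fmap_comp A G F = (compose (Obj A) (fst G) (fst F), compose (Arr A) (snd G) (snd F))"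

definition discrete_fibration ::
  "('x, 'y) cat \<Rightarrow> ('o, 'a, 'x, 'y) cat_over \<Rightarrow> bool" where
  "discrete_fibration X A \<longleftrightarrow> category_over X A \<and>
     (\<forall>a\<in>Obj A. \<forall>f\<in>Arr X. Cod X f = prO A a \<longrightarrow>
        (\<exists>!l. l \<in> Arr A \<and> Cod A l = a \<and> prA A l = f))"

definition discrete_opfibration ::
  "('x, 'y) cat \<Rightarrow> ('o, 'a, 'x, 'y) cat_over \<Rightarrow> bool" where
  "discrete_opfibration X A \<longleftrightarrow> category_over X A \<and>
     (\<forall>a\<in>Obj A. \<forall>f\<in>Arr X. Dom X f = prO A a \<longrightarrow>
        (\<exists>!l. l \<in> Arr A \<and> Dom A l = a \<and> prA A l = f))"

definition fiber :: "('o, 'a, 'x, 'y) cat_over \<Rightarrow> 'x \<Rightarrow> 'o set" where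
  "fiber A x = {a \<in> Obj A. prO A a = x}"

(* (C, e) is a coreflection of P: e : C --> P is a universal arrow from the full
   subcategory of discrete (op)fibrations to P, that is, the component at P of the
   counit of the adjunction between the inclusion and its right adjoint.
   HOL cannot quantify over types inside a formula, so the first two arguments name the
   types of objects and arrows of the discrete (op)fibrations for which the universal
   property is required.  A coreflection satisfies this at all types; assuming it
   at particular ones only is a weaker hypothesis. *)
definition fib_coreflection ::
  "'e itself \<Rightarrow> 'f itself \<Rightarrow> ('x, 'y) cat \<Rightarrow> ('o, 'a, 'x, 'y) cat_over
    \<Rightarrow> ('c, 'd, 'x, 'y) cat_over \<Rightarrow> ('c, 'd, 'o, 'a) fmap \<Rightarrow> bool" where
  "fib_coreflection TE TF X P C e \<longleftrightarrow>
     discrete_fibration X C \<and> e \<in> over_hom C P \<and>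
     (\<forall>A :: ('e, 'f, 'x, 'y) cat_over. discrete_fibration X A \<longrightarrow>
        (\<forall>F\<in>over_hom A P. \<exists>!G. G \<in> over_hom A C \<and> fmap_comp A e G = F))"

definition opfib_coreflection ::
  "'e itself \<Rightarrow> 'f itself \<Rightarrow> ('x, 'y) cat \<Rightarrow> ('o, 'a, 'x, 'y) cat_over
    \<Rightarrow> ('c, 'd, 'x, 'y) cat_over \<Rightarrow> ('c, 'd, 'o, 'a) fmap \<Rightarrow> bool" where
  "opfib_coreflection TE TF X P C e \<longleftrightarrow>
     discrete_opfibration X C \<and> e \<in> over_hom C P \<and>
     (\<forall>A :: ('e, 'f, 'x, 'y) cat_over. discrete_opfibration X A \<longrightarrow>
        (\<forall>F\<in>over_hom A P. \<exists>!G. G \<in> over_hom A C \<and> fmap_comp A e G = F))"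

(* An arrow u --> v of X/x is a triple (u, h, v) with v h = u;
   an arrow u --> v of x/X is a triple (u, h, v) with h u = v. *)
definition slice :: "('x, 'y) cat \<Rightarrow> 'x \<Rightarrow> ('y, 'y \<times> 'y \<times> 'y, 'x, 'y) cat_over" where
  "slice X x = \<lparr>
     Obj = {u \<in> Arr X. Cod X u = x},
     Arr = {(u, h, v). u \<in> Arr X \<and> h \<in> Arr X \<and> v \<in> Arr X \<and> Cod X u = x \<and> Cod X v = x \<and>
              Dom X h = Dom X u \<and> Cod X h = Dom X v \<and> Comp X v h = u},
     Dom = (\<lambda>(u, h, v). u),
     Cod = (\<lambda>(u, h, v). v),
     Ide = (\<lambda>u. (u, Ide X (Dom X u), u)),
     Comp = (\<lambda>(v', k, w) (u, h, v). (u, Comp X k h, w)),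
     prO = Dom X,
     prA = (\<lambda>(u, h, v). h)\<rparr>"

definition coslice :: "('x, 'y) cat \<Rightarrow> 'x \<Rightarrow> ('y, 'y \<times> 'y \<times> 'y, 'x, 'y) cat_over" where
  "coslice X x = \<lparr>
     Obj = {u \<in> Arr X. Dom X u = x},
     Arr = {(u, h, v). u \<in> Arr X \<and> h \<in> Arr X \<and> v \<in> Arr X \<and> Dom X u = x \<and> Dom X v = x \<and>
              Dom X h = Cod X u \<and> Cod X h = Cod X v \<and> Comp X h u = v},
     Dom = (\<lambda>(u, h, v). u),
     Cod = (\<lambda>(u, h, v). v),
     Ide = (\<lambda>u. (u, Ide X (Cod X u), u)),
     Comp = (\<lambda>(v', k, w) (u, h, v). (u, Comp X k h, w)),
     prO = Cod X,
     prA = (\<lambda>(u, h, v). h)\<rparr>"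

(* slice_map X f : X / Dom f --> X / Cod f composes with f on the left;
   coslice_map X f : Cod f / X --> Dom f / X composes with f on the right. *)
definition slice_map ::
  "('x, 'y) cat \<Rightarrow> 'y \<Rightarrow> ('y, 'y \<times> 'y \<times> 'y, 'y, 'y \<times> 'y \<times> 'y) fmap" where
  "slice_map X f =
     (restrict (\<lambda>u. Comp X f u) (Obj (slice X (Dom X f))),
      restrict (\<lambda>(u, h, v). (Comp X f u, h, Comp X f v)) (Arr (slice X (Dom X f))))"

definition coslice_map ::
  "('x, 'y) cat \<Rightarrow> 'y \<Rightarrow> ('y, 'y \<times> 'y \<times> 'y, 'y, 'y \<times> 'y \<times> 'y) fmap" where
  "coslice_map X f =
     (restrict (\<lambda>u. Comp X u f) (Obj (coslice X (Cod X f))),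
      restrict (\<lambda>(u, h, v). (Comp X u f, h, Comp X v f)) (Arr (coslice X (Cod X f))))"

end

theory Submission
  imports Defs
begin

text \<open>By the universal property of the counit, maps from a discrete fibration \<open>S\<close> to \<open>P\<close>
  correspond to maps from \<open>S\<close> to \<open>C\<close>. If \<open>S\<close> has a terminal object \<open>t\<close> over \<open>x\<close>, such a map
  is determined by the image of \<open>t\<close>, which can be any object of the fiber of \<open>C\<close> over \<open>x\<close>: this
  is the Yoneda lemma, proved by lifting the projections of the arrows to \<open>t\<close>. The slice has a
  terminal object, the identity of \<open>x\<close>. The case of opfibrations follows by passing to opposite
  categories, which changes neither the maps over \<open>X\<close> nor the fibers.\<close>

section \<open>Morphisms over a base and their composition\<close>

lemma over_homE:
  assumes "G \<in> over_hom A B"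
  shows "is_functor A B (fst G) (snd G)"
    and "fst G \<in> extensional (Obj A)" and "snd G \<in> extensional (Arr A)"
    and "a \<in> Obj A \<Longrightarrow> prO B (fst G a) = prO A a"
    and "f \<in> Arr A \<Longrightarrow> prA B (snd G f) = prA A f"
  using assms by (auto simp: over_hom_def)

lemma over_homI:
  assumes "is_functor A B (fst G) (snd G)"
    and "fst G \<in> extensional (Obj A)" and "snd G \<in> extensional (Arr A)"
    and "\<And>a. a \<in> Obj A \<Longrightarrow> prO B (fst G a) = prO A a"
    and "\<And>f. f \<in> Arr A \<Longrightarrow> prA B (snd G f) = prA A f"
  shows "G \<in> over_hom A B"
  using assms by (cases G) (auto simp: over_hom_def)

lemma fmap_comp_over_hom:
  assumes "F \<in> over_hom A B" "G \<in> over_hom B C"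
  shows "fmap_comp A G F \<in> over_hom A C"
proof -
  interpret F: is_functor A B "fst F" "snd F" using assms(1) by (rule over_homE)
  interpret G: is_functor B C "fst G" "snd G" using assms(2) by (rule over_homE)
  show ?thesis
  proof (rule over_homI)
    show "is_functor A C (fst (fmap_comp A G F)) (snd (fmap_comp A G F))"
      by unfold_locales
        (auto simp: fmap_comp_def compose_eq F.map_Obj F.map_Arr F.map_Dom F.map_Cod F.map_Ide
          F.map_Comp G.map_Obj G.map_Arr G.map_Dom G.map_Cod G.map_Ide G.map_Comp
          F.A.Dom_closed F.A.Cod_closed F.A.Ide_closed F.A.Comp_closed)
  qed (auto simp: fmap_comp_def compose_eq F.map_Obj F.map_Arr over_homE(4,5)[OF assms(1)]
      over_homE(4,5)[OF assms(2)])
qed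

text \<open>Composites are restricted to the objects and arrows of their source, so the inner
  composite on the left is \<open>undefined\<close> outside \<open>B\<close>. The hypothesis keeps
  the values of \<open>F\<close> inside \<open>B\<close>.\<close>

lemma fmap_comp_assoc:
  assumes "F \<in> over_hom A B"
  shows "fmap_comp A (fmap_comp B H G) F = fmap_comp A H (fmap_comp A G F)"
proof -
  interpret F: is_functor A B "fst F" "snd F" using assms by (rule over_homE)
  show ?thesis
    by (auto simp: fmap_comp_def compose_def fun_eq_iff F.map_Obj F.map_Arr)
qed

section \<open>Terminal objects and the Yoneda lemma for discrete fibrations\<close>

definition terminal_in :: "('o, 'a, 'm) cat_scheme \<Rightarrow> 'o \<Rightarrow> bool" where
  "terminal_in S t \<longleftrightarrow>
     t \<in> Obj S \<and> (\<forall>s\<in>Obj S. \<exists>!k. k \<in> Arr S \<and> Dom S k = s \<and> Cod S k = t)"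

text \<open>Both arrows lift the same arrow of \<open>X\<close> at the same object. This is how
  equations between arrows of a discrete fibration are proved below: compare codomains and
  projections.\<close>

lemma discrete_fibration_unique:
  assumes "discrete_fibration X C" "k \<in> Arr C" "l \<in> Arr C" "Cod C k = Cod C l"
    "prA C k = prA C l"
  shows "k = l"
proof -
  interpret is_functor C X "prO C" "prA C"
    using assms(1) by (simp add: discrete_fibration_def category_over_def)
  have "\<exists>!m. m \<in> Arr C \<and> Cod C m = Cod C l \<and> prA C m = prA C l"
    using assms(1,3) by (simp add: discrete_fibration_def A.Cod_closed map_Arr map_Cod)
  then show ?thesis using assms by blast
qed

text \<open>An object \<open>s\<close> has an arrow to \<open>t\<close>. Its images under
  \<open>G\<close> and \<open>H\<close> end at the same object and lie over the same arrow of
  \<open>X\<close>, so they coincide, and so do their domains, the images of \<open>s\<close>. Once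
  the objects agree, the same argument covers every arrow.\<close>

lemma over_hom_eq_if_eq_at_terminal:
  assumes C: "discrete_fibration X C" and t: "terminal_in S t"
    and G: "G \<in> over_hom S C" and H: "H \<in> over_hom S C" and eq: "fst G t = fst H t"
  shows "G = H"
proof -
  interpret G: is_functor S C "fst G" "snd G" using G by (rule over_homE)
  interpret H: is_functor S C "fst H" "snd H" using H by (rule over_homE)
  have arr: "snd G k = snd H k" if "k \<in> Arr S" "fst G (Cod S k) = fst H (Cod S k)" for k
    using that by (intro discrete_fibration_unique[OF C])
      (auto simp: G.map_Arr H.map_Arr G.map_Cod H.map_Cod over_homE(5)[OF G] over_homE(5)[OF H])
  have obj: "fst G s = fst H s" if s: "s \<in> Obj S" for s
  proof -
    obtain k where k: "k \<in> Arr S" "Dom S k = s" "Cod S k = t"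
      using t s by (auto simp: terminal_in_def)
    with arr[of k] eq have "snd G k = snd H k" by simp
    then show ?thesis using G.map_Dom[of k] H.map_Dom[of k] k by simp
  qed
  have "fst G = fst H"
    using over_homE(2)[OF G] over_homE(2)[OF H] obj by (rule extensionalityI)
  moreover have "snd G = snd H"
    using over_homE(3)[OF G] over_homE(3)[OF H]
    by (rule extensionalityI) (simp add: arr obj G.A.Cod_closed)
  ultimately show ?thesis by (rule prod_eqI)
qed

lemma over_hom_exists_at_terminal:
  assumes C: "discrete_fibration X C" and S: "category_over X S" and t: "terminal_in S t"
    and c: "c \<in> fiber C (prO S t)"
  shows "\<exists>G\<in>over_hom S C. fst G t = c"
proof -
  interpret C: is_functor C X "prO C" "prA C"
    using C by (simp add: discrete_fibration_def category_over_def)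
  interpret S: is_functor S X "prO S" "prA S"
    using S by (simp add: category_over_def)
  have c': "c \<in> Obj C" "prO C c = prO S t" using c by (auto simp: fiber_def)
  \<comment> \<open>Meaningful only when \<open>f\<close> ends at \<open>prO C b\<close>; the domain
    of \<open>lift f b\<close> is then the restriction of \<open>b\<close> along
    \<open>f\<close>.\<close>
  define lift where "lift f b = (THE l. l \<in> Arr C \<and> Cod C l = b \<and> prA C l = f)" for f b
  have lift: "lift f b \<in> Arr C" "Cod C (lift f b) = b" "prA C (lift f b) = f"
    if "b \<in> Obj C" "f \<in> Arr X" "Cod X f = prO C b" for f b
  proof -
    have "\<exists>!l. l \<in> Arr C \<and> Cod C l = b \<and> prA C l = f"
      using C that by (simp add: discrete_fibration_def)
    from theI'[OF this]
    show "lift f b \<in> Arr C" "Cod C (lift f b) = b" "prA C (lift f b) = f"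
      by (simp_all add: lift_def)
  qed
  note unique = discrete_fibration_unique[OF C]
  define \<tau> where "\<tau> s = (THE k. k \<in> Arr S \<and> Dom S k = s \<and> Cod S k = t)" for s
  have \<tau>: "\<tau> s \<in> Arr S" "Dom S (\<tau> s) = s" "Cod S (\<tau> s) = t" if "s \<in> Obj S" for s
  proof -
    have "\<exists>!k. k \<in> Arr S \<and> Dom S k = s \<and> Cod S k = t"
      using t that by (simp add: terminal_in_def)
    from theI'[OF this] show "\<tau> s \<in> Arr S" "Dom S (\<tau> s) = s" "Cod S (\<tau> s) = t"
      by (simp_all add: \<tau>_def)
  qed
  have \<tau>_unique: "k = \<tau> (Dom S k)" if "k \<in> Arr S" "Cod S k = t" for k
    using that t \<tau>[of "Dom S k"] S.A.Dom_closed[of k] unfolding terminal_in_def by blast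
  \<comment> \<open>The arrow from \<open>s\<close> to \<open>t\<close> has to go to the lift of its
    projection ending at \<open>c\<close>, which forces the value at \<open>s\<close>.\<close>
  define go where "go s = Dom C (lift (prA S (\<tau> s)) c)" for s
  define ga where "ga k = lift (prA S k) (go (Cod S k))" for k
  have lift_\<tau>: "lift (prA S (\<tau> s)) c \<in> Arr C" "Cod C (lift (prA S (\<tau> s)) c) = c"
    "prA C (lift (prA S (\<tau> s)) c) = prA S (\<tau> s)" if "s \<in> Obj S" for s
    using lift[of c "prA S (\<tau> s)"] that c' by (simp_all add: \<tau> S.map_Arr S.map_Cod)
  have go: "go s \<in> Obj C" "prO C (go s) = prO S s" if "s \<in> Obj S" for s
    using that C.map_Dom[OF lift_\<tau>(1)[OF that]]
    by (simp_all add: go_def C.A.Dom_closed lift_\<tau> S.map_Dom \<tau>)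
  have ga: "ga k \<in> Arr C" "Cod C (ga k) = go (Cod S k)" "prA C (ga k) = prA S k"
    if "k \<in> Arr S" for k
    using lift[of "go (Cod S k)" "prA S k"] that
    by (simp_all add: ga_def go S.A.Cod_closed S.map_Arr S.map_Cod)
  \<comment> \<open>Lifting prescribes codomains only; the domain comes from the terminality of
    \<open>t\<close>. Following \<open>ga k\<close> by the lift attached to \<open>Cod S k\<close>
    gives an arrow ending at \<open>c\<close>. It lies over the projection of the composite of
    \<open>k\<close> with the arrow to \<open>t\<close>, which is the arrow from
    \<open>Dom S k\<close> to \<open>t\<close>. Hence it is the lift whose domain defines
    \<open>go (Dom S k)\<close>.\<close>
  have ga_Dom: "Dom C (ga k) = go (Dom S k)" if k: "k \<in> Arr S" for k
  proof -
    let ?s = "Cod S k" and ?r = "Dom S k"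
    let ?l = "lift (prA S (\<tau> ?s)) c"
    have s: "?s \<in> Obj S" "?r \<in> Obj S" using k by (simp_all add: S.A.Cod_closed S.A.Dom_closed)
    have match: "Dom C ?l = Cod C (ga k)" using ga k by (simp add: go_def)
    have "Comp S (\<tau> ?s) k = \<tau> (Dom S (Comp S (\<tau> ?s) k))"
      using k s by (intro \<tau>_unique) (simp_all add: \<tau> S.A.Comp_closed S.A.Cod_Comp)
    then have \<tau>_comp: "Comp S (\<tau> ?s) k = \<tau> ?r" using k s by (simp add: \<tau> S.A.Dom_Comp)
    have "prA C (Comp C ?l (ga k)) = prA S (Comp S (\<tau> ?s) k)"
      using k s match by (simp add: C.map_Comp ga lift_\<tau> S.map_Comp \<tau>)
    then have "Comp C ?l (ga k) = lift (prA S (\<tau> ?r)) c"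
      using k s match
      by (intro unique) (simp_all add: ga lift_\<tau> C.A.Comp_closed C.A.Cod_Comp \<tau>_comp)
    moreover have "Dom C (Comp C ?l (ga k)) = Dom C (ga k)"
      using k s match by (intro C.A.Dom_Comp) (simp_all add: ga lift_\<tau>)
    ultimately show ?thesis by (simp add: go_def)
  qed
  have tO: "t \<in> Obj S" using t by (simp add: terminal_in_def)
  \<comment> \<open>The only endomorphism of \<open>t\<close> is its identity, and an identity lifts
    to an identity.\<close>
  have go_t: "go t = c"
  proof -
    have "Ide S t = \<tau> t"
      using \<tau>_unique[of "Ide S t"] tO by (simp add: S.A.Ide_closed S.A.Cod_Ide S.A.Dom_Ide)
    then have "prA S (\<tau> t) = Ide X (prO S t)" using S.map_Ide[OF tO] by simp
    then have "lift (prA S (\<tau> t)) c = Ide C c"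
      using lift_\<tau>[OF tO] c'
      by (intro unique) (simp_all add: C.A.Ide_closed C.A.Cod_Ide C.map_Ide)
    then show ?thesis using c' by (simp add: go_def C.A.Dom_Ide)
  qed
  have ga_Ide: "ga (Ide S s) = Ide C (go s)" if "s \<in> Obj S" for s
    using that
    by (intro unique) (simp_all add: ga go S.A.Ide_closed S.A.Cod_Ide C.A.Ide_closed
        C.A.Cod_Ide C.map_Ide S.map_Ide)
  \<comment> \<open>The right side is a genuine composite by \<open>ga_Dom\<close>; it then has the
    codomain and the projection of the left side.\<close>
  have ga_Comp: "ga (Comp S g f) = Comp C (ga g) (ga f)"
    if "f \<in> Arr S" "g \<in> Arr S" "Dom S g = Cod S f" for f g
    using that
    by (intro unique) (simp_all add: ga ga_Dom S.A.Comp_closed S.A.Cod_Comp C.A.Comp_closed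
        C.A.Cod_Comp C.map_Comp S.map_Comp)
  let ?G = "(restrict go (Obj S), restrict ga (Arr S))"
  have "?G \<in> over_hom S C"
  proof (rule over_homI)
    show "is_functor S C (fst ?G) (snd ?G)"
      by unfold_locales
        (auto simp: go ga ga_Dom ga_Ide ga_Comp S.A.Dom_closed S.A.Cod_closed S.A.Ide_closed
          S.A.Comp_closed)
  qed (auto simp: go ga)
  moreover have "fst ?G t = c" using tO go_t by simp
  ultimately show ?thesis by blast
qed

lemma bij_betw_eval_terminal:
  assumes C: "discrete_fibration X C" and S: "category_over X S" and t: "terminal_in S t"
  shows "bij_betw (\<lambda>G. fst G t) (over_hom S C) (fiber C (prO S t))"
proof (rule bij_betw_imageI)
  show "inj_on (\<lambda>G. fst G t) (over_hom S C)"
    by (rule inj_onI) (rule over_hom_eq_if_eq_at_terminal[OF C t])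
  have "fst G t \<in> fiber C (prO S t)" if "G \<in> over_hom S C" for G
    using t is_functor.map_Obj[OF over_homE(1)[OF that]] over_homE(4)[OF that]
    by (simp add: fiber_def terminal_in_def)
  then show "(\<lambda>G. fst G t) ` over_hom S C = fiber C (prO S t)"
    using over_hom_exists_at_terminal[OF C S t] by blast
qed

section \<open>Fibers of a coreflection, represented by a family with terminal objects\<close>

text \<open>The family \<open>S\<close> with its transition maps \<open>m\<close> stands for the slices of \<open>X\<close>; keeping it
  abstract lets the lemma apply to the opposites of the coslices, which agree with the slices of
  the opposite category only up to a swap of the components of arrows.\<close>

lemma fib_coreflection_fibers:
  fixes S :: "'x \<Rightarrow> ('e, 'f, 'x, 'y) cat_over"
  assumes corefl: "fib_coreflection TYPE('e) TYPE('f) X P C e"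
    and S: "\<And>x. x \<in> Obj X \<Longrightarrow> discrete_fibration X (S x)"
    and t: "\<And>x. x \<in> Obj X \<Longrightarrow> terminal_in (S x) (t x)"
    and prO_t: "\<And>x. x \<in> Obj X \<Longrightarrow> prO (S x) (t x) = x"
    and m: "\<And>f. f \<in> Arr X \<Longrightarrow> m f \<in> over_hom (S (Dom X f)) (S (Cod X f))"
    and m_t: "\<And>f. f \<in> Arr X \<Longrightarrow> \<exists>k\<in>Arr (S (Cod X f)).
      Dom (S (Cod X f)) k = fst (m f) (t (Dom X f)) \<and> Cod (S (Cod X f)) k = t (Cod X f) \<and>
      prA (S (Cod X f)) k = f"
  shows "\<exists>\<phi>. (\<forall>x\<in>Obj X. bij_betw (\<phi> x) (fiber C x) (over_hom (S x) P)) \<and>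
              (\<forall>l\<in>Arr C. \<phi> (prO C (Dom C l)) (Dom C l) =
                 fmap_comp (S (prO C (Dom C l)))
                   (\<phi> (prO C (Cod C l)) (Cod C l)) (m (prA C l)))"
proof -
  have C: "discrete_fibration X C" and e: "e \<in> over_hom C P"
    and univ: "\<And>(A :: ('e, 'f, 'x, 'y) cat_over) F. discrete_fibration X A \<Longrightarrow>
      F \<in> over_hom A P \<Longrightarrow> \<exists>!G. G \<in> over_hom A C \<and> fmap_comp A e G = F"
    using corefl by (auto simp: fib_coreflection_def)
  interpret C: is_functor C X "prO C" "prA C"
    using C by (simp add: discrete_fibration_def category_over_def)
  \<comment> \<open>The inverse of the Yoneda bijection: \<open>Y x c\<close> is the map that takes
    \<open>t x\<close> to \<open>c\<close>.\<close>
  define Y where "Y x = the_inv_into (over_hom (S x) C) (\<lambda>G. fst G (t x))" for x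
  have ev: "bij_betw (\<lambda>G. fst G (t x)) (over_hom (S x) C) (fiber C x)" if "x \<in> Obj X" for x
    using bij_betw_eval_terminal[OF C _ t[OF that]] S[OF that] prO_t[OF that]
    by (simp add: discrete_fibration_def)
  have Y_bij: "bij_betw (Y x) (fiber C x) (over_hom (S x) C)" if "x \<in> Obj X" for x
    using ev[OF that] unfolding Y_def by (rule bij_betw_the_inv_into)
  have Y: "Y x c \<in> over_hom (S x) C" "fst (Y x c) (t x) = c"
    if "x \<in> Obj X" "c \<in> fiber C x" for x c
    using Y_bij[OF that(1)] that(2) f_the_inv_into_f_bij_betw[OF ev[OF that(1)]]
    by (auto simp: Y_def bij_betw_def)
  \<comment> \<open>This is the universal property of \<open>e\<close> with \<open>S x\<close> as
    test object; existence gives surjectivity and uniqueness gives injectivity.\<close>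
  have e_bij: "bij_betw (\<lambda>G. fmap_comp (S x) e G) (over_hom (S x) C) (over_hom (S x) P)"
    if "x \<in> Obj X" for x
  proof (rule bij_betw_imageI)
    have closed: "fmap_comp (S x) e G \<in> over_hom (S x) P" if "G \<in> over_hom (S x) C" for G
      using that e by (rule fmap_comp_over_hom)
    show "inj_on (\<lambda>G. fmap_comp (S x) e G) (over_hom (S x) C)"
      using univ[OF S[OF that]] closed by (blast intro!: inj_onI)
    show "(\<lambda>G. fmap_comp (S x) e G) ` over_hom (S x) C = over_hom (S x) P"
      using univ[OF S[OF that]] closed by blast
  qed
  \<comment> \<open>It suffices to compare both sides at the terminal object. The arrow
    \<open>k\<close> from \<open>m_t\<close> lies over \<open>prA C l\<close> and ends at a terminal
    object sent to \<open>Cod C l\<close>, so its image is \<open>l\<close> by unique lifting. Hence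
    the domain of \<open>k\<close> is sent to \<open>Dom C l\<close>.\<close>
  have nat: "Y (prO C (Dom C l)) (Dom C l) =
      fmap_comp (S (prO C (Dom C l))) (Y (prO C (Cod C l)) (Cod C l)) (m (prA C l))"
    if l: "l \<in> Arr C" for l
  proof -
    define f where "f = prA C l"
    have f: "f \<in> Arr X" "prO C (Dom C l) = Dom X f" "prO C (Cod C l) = Cod X f"
      using l by (simp_all add: f_def C.map_Arr C.map_Dom C.map_Cod)
    have dom: "Dom X f \<in> Obj X" "Dom C l \<in> fiber C (Dom X f)"
      and cod: "Cod X f \<in> Obj X" "Cod C l \<in> fiber C (Cod X f)"
      using l f by (simp_all add: fiber_def C.A.Dom_closed C.A.Cod_closed C.B.Dom_closed
          C.B.Cod_closed)
    let ?G = "Y (Cod X f) (Cod C l)"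
    interpret G: is_functor "S (Cod X f)" C "fst ?G" "snd ?G"
      using Y(1)[OF cod] by (rule over_homE)
    obtain k where k: "k \<in> Arr (S (Cod X f))"
      "Dom (S (Cod X f)) k = fst (m f) (t (Dom X f))" "Cod (S (Cod X f)) k = t (Cod X f)"
      "prA (S (Cod X f)) k = f"
      using m_t[OF f(1)] by blast
    have "snd ?G k = l"
      using k l Y(2)[OF cod] over_homE(5)[OF Y(1)[OF cod]]
      by (intro discrete_fibration_unique[OF C]) (simp_all add: G.map_Arr G.map_Cod flip: f_def)
    then have "fst ?G (fst (m f) (t (Dom X f))) = Dom C l"
      using G.map_Dom[OF k(1)] k(2) by simp
    moreover have "t (Dom X f) \<in> Obj (S (Dom X f))"
      using t[OF dom(1)] by (simp add: terminal_in_def)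
    ultimately have "fst (fmap_comp (S (Dom X f)) ?G (m f)) (t (Dom X f)) = Dom C l"
      by (simp add: fmap_comp_def compose_eq)
    then have "Y (Dom X f) (Dom C l) = fmap_comp (S (Dom X f)) ?G (m f)"
      using Y[OF dom] m[OF f(1)] Y(1)[OF cod]
      by (intro over_hom_eq_if_eq_at_terminal[OF C t[OF dom(1)]] fmap_comp_over_hom) simp_all
    then show ?thesis by (simp add: f flip: f_def)
  qed
  \<comment> \<open>Composing with the counit turns maps to \<open>C\<close> into maps to
    \<open>P\<close>; associativity carries the compatibility with \<open>m\<close> along.\<close>
  define \<phi> where "\<phi> x c = fmap_comp (S x) e (Y x c)" for x c
  have "bij_betw (\<phi> x) (fiber C x) (over_hom (S x) P)" if "x \<in> Obj X" for x
    using bij_betw_trans[OF Y_bij[OF that] e_bij[OF that]] by (simp add: \<phi>_def[abs_def] comp_def)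
  moreover have "\<phi> (prO C (Dom C l)) (Dom C l) =
      fmap_comp (S (prO C (Dom C l))) (\<phi> (prO C (Cod C l)) (Cod C l)) (m (prA C l))"
    if l: "l \<in> Arr C" for l
  proof -
    have "m (prA C l) \<in> over_hom (S (prO C (Dom C l))) (S (prO C (Cod C l)))"
      using m[of "prA C l"] l by (simp add: C.map_Arr C.map_Dom C.map_Cod)
    then show ?thesis unfolding \<phi>_def using fmap_comp_assoc nat[OF l] by metis
  qed
  ultimately show ?thesis by blast
qed

section \<open>Opposite categories and duality\<close>

text \<open>A record update on the extensible record type serves plain categories and categories
  over \<open>X\<close> alike: the projections are kept, and now lead to the opposite base.\<close>

definition op_cat :: "('o, 'a, 'm) cat_scheme \<Rightarrow> ('o, 'a, 'm) cat_scheme" where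
  "op_cat A = A\<lparr>Dom := Cod A, Cod := Dom A, Comp := (\<lambda>g f. Comp A f g)\<rparr>"

lemma op_cat_simps [simp]:
  "Obj (op_cat A) = Obj A" "Arr (op_cat A) = Arr A" "Dom (op_cat A) = Cod A"
  "Cod (op_cat A) = Dom A" "Ide (op_cat A) = Ide A" "Comp (op_cat A) g f = Comp A f g"
  by (simp_all add: op_cat_def)

lemma op_cat_over_simps [simp]:
  "prO (op_cat B) = prO B" "prA (op_cat B) = prA B"
  by (simp_all add: op_cat_def)

lemma op_cat_op_cat [simp]: "op_cat (op_cat A) = A"
  by (simp add: op_cat_def)

lemma category_op_cat: "category A \<Longrightarrow> category (op_cat A)"
  unfolding category_def by simp

lemma is_functor_op_cat:
  "is_functor A B Fo Fa \<Longrightarrow> is_functor (op_cat A) (op_cat B) Fo Fa"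
  unfolding is_functor_def is_functor_axioms_def by (simp add: category_op_cat)

lemma is_functor_op_cat_iff [simp]:
  "is_functor (op_cat A) (op_cat B) Fo Fa \<longleftrightarrow> is_functor A B Fo Fa"
  using is_functor_op_cat[of A B Fo Fa] is_functor_op_cat[of "op_cat A" "op_cat B" Fo Fa] by auto

lemma over_hom_op_cat [simp]: "over_hom (op_cat A) (op_cat B) = over_hom A B"
  by (simp add: over_hom_def)

lemma fiber_op_cat [simp]: "fiber (op_cat A) x = fiber A x"
  by (simp add: fiber_def)

lemma fmap_comp_op_cat [simp]: "fmap_comp (op_cat A) G F = fmap_comp A G F"
  by (simp add: fmap_comp_def)

lemma discrete_fibration_op_cat [simp]:
  "discrete_fibration (op_cat X) (op_cat A) \<longleftrightarrow> discrete_opfibration X A"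
  by (simp add: discrete_fibration_def discrete_opfibration_def category_over_def)

text \<open>Since \<open>op_cat\<close> is an involution, every discrete fibration \<open>A\<close>
  over \<open>op_cat X\<close> is the opposite of the discrete opfibration \<open>op_cat A\<close>
  over \<open>X\<close>, at the same types, to which the given universal property applies.\<close>

lemma fib_coreflection_op_cat:
  fixes X :: "('x, 'y) cat"
  assumes "opfib_coreflection TYPE('e) TYPE('f) X P D d"
  shows "fib_coreflection TYPE('e) TYPE('f) (op_cat X) (op_cat P) (op_cat D) d"
proof -
  have "\<exists>!G. G \<in> over_hom A (op_cat D) \<and> fmap_comp A d G = F"
    if "discrete_fibration (op_cat X) A" "F \<in> over_hom A (op_cat P)"
    for A :: "('e, 'f, 'x, 'y) cat_over" and F
  proof -
    have "discrete_opfibration X (op_cat A)" "F \<in> over_hom (op_cat A) P"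
      using that discrete_fibration_op_cat[of X "op_cat A"] over_hom_op_cat[of "op_cat A" P]
      by simp_all
    then have "\<exists>!G. G \<in> over_hom (op_cat A) D \<and> fmap_comp (op_cat A) d G = F"
      using assms by (simp add: opfib_coreflection_def del: fmap_comp_op_cat)
    then show ?thesis using over_hom_op_cat[of "op_cat A" D] by simp
  qed
  then show ?thesis
    using assms unfolding fib_coreflection_def opfib_coreflection_def by simp
qed

section \<open>Slices, coslices and their transition maps\<close>

context
  fixes X :: "('x, 'y) cat"
  assumes "category X"
begin

interpretation X: category X by fact

text \<open>The composite determines the first component and its endpoints, so only a composable
  pair \<open>h\<close>, \<open>v\<close> remains as free data.\<close>

lemma slice_Arr:
  "(u, h, v) \<in> Arr (slice X x) \<longleftrightarrow>
     h \<in> Arr X \<and> v \<in> Arr X \<and> Dom X v = Cod X h \<and> Cod X v = x \<and> u = Comp X v h"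
  unfolding slice_def by simp (metis X.Comp_closed X.Dom_Comp X.Cod_Comp)

lemma slice_simps:
  "Obj (slice X x) = {u \<in> Arr X. Cod X u = x}"
  "Dom (slice X x) k = fst k" "Cod (slice X x) k = snd (snd k)"
  "Ide (slice X x) u = (u, Ide X (Dom X u), u)"
  "Comp (slice X x) g f = (fst f, Comp X (fst (snd g)) (fst (snd f)), snd (snd g))"
  "prO (slice X x) = Dom X" "prA (slice X x) k = fst (snd k)"
  by (auto simp: slice_def split: prod.splits)

lemma coslice_Arr:
  "(u, h, v) \<in> Arr (coslice X x) \<longleftrightarrow>
     u \<in> Arr X \<and> h \<in> Arr X \<and> Dom X h = Cod X u \<and> Dom X u = x \<and> v = Comp X h u"
  unfolding coslice_def by simp (metis X.Comp_closed X.Dom_Comp X.Cod_Comp)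

lemma coslice_simps:
  "Obj (coslice X x) = {u \<in> Arr X. Dom X u = x}"
  "Dom (coslice X x) k = fst k" "Cod (coslice X x) k = snd (snd k)"
  "Ide (coslice X x) u = (u, Ide X (Cod X u), u)"
  "Comp (coslice X x) g f = (fst f, Comp X (fst (snd g)) (fst (snd f)), snd (snd g))"
  "prO (coslice X x) = Cod X" "prA (coslice X x) k = fst (snd k)"
  by (auto simp: coslice_def split: prod.splits)

text \<open>With the object as a separate variable, the identity law still rewrites after
  \<open>Dom X f\<close> has been replaced by an equal term.\<close>

lemma Comp_Ide_eq: "\<lbrakk>f \<in> Arr X; Dom X f = x\<rbrakk> \<Longrightarrow> Comp X f (Ide X x) = f"
  using X.Comp_Ide by blast

lemma Ide_Comp_eq: "\<lbrakk>f \<in> Arr X; Cod X f = x\<rbrakk> \<Longrightarrow> Comp X (Ide X x) f = f"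
  using X.Ide_Comp by blast

lemmas X_simps = X.Dom_closed X.Cod_closed X.Ide_closed X.Dom_Ide X.Cod_Ide X.Comp_closed
  X.Dom_Comp X.Cod_Comp Comp_Ide_eq Ide_Comp_eq

lemma slice_is_functor: "is_functor (slice X x) X (prO (slice X x)) (prA (slice X x))"
  by unfold_locales (auto simp: slice_simps slice_Arr X_simps X.Comp_assoc split_paired_all)

lemma coslice_is_functor: "is_functor (coslice X x) X (prO (coslice X x)) (prA (coslice X x))"
  by unfold_locales (auto simp: coslice_simps coslice_Arr X_simps X.Comp_assoc split_paired_all)

text \<open>A lift of \<open>f\<close> ending at \<open>a\<close> has last component
  \<open>a\<close> and middle component \<open>f\<close>; the commuting triangle forces the
  first.\<close>

lemma discrete_fibration_slice: "discrete_fibration X (slice X x)"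
proof -
  have "\<exists>!l. l \<in> Arr (slice X x) \<and> Cod (slice X x) l = a \<and> prA (slice X x) l = f"
    if "a \<in> Obj (slice X x)" "f \<in> Arr X" "Cod X f = prO (slice X x) a" for a f
    using that
    by (intro ex1I[of _ "(Comp X a f, f, a)"])
      (auto simp: slice_simps slice_Arr X_simps)
  then show ?thesis
    by (simp add: discrete_fibration_def category_over_def slice_is_functor)
qed

lemma discrete_opfibration_coslice: "discrete_opfibration X (coslice X x)"
proof -
  have "\<exists>!l. l \<in> Arr (coslice X x) \<and> Dom (coslice X x) l = a \<and> prA (coslice X x) l = f"
    if "a \<in> Obj (coslice X x)" "f \<in> Arr X" "Dom X f = prO (coslice X x) a" for a f
    using that
    by (intro ex1I[of _ "(a, f, Comp X f a)"])
      (auto simp: coslice_simps coslice_Arr X_simps)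
  then show ?thesis
    by (simp add: discrete_opfibration_def category_over_def coslice_is_functor)
qed

text \<open>The triangle over the identity says that the middle component of an arrow from
  \<open>u\<close> is \<open>u\<close> itself.\<close>

lemma terminal_in_slice:
  assumes x: "x \<in> Obj X"
  shows "terminal_in (slice X x) (Ide X x)"
proof -
  have "\<exists>!k. k \<in> Arr (slice X x) \<and> Dom (slice X x) k = u \<and> Cod (slice X x) k = Ide X x"
    if u: "u \<in> Obj (slice X x)" for u
  proof (intro ex1I[of _ "(u, u, Ide X x)"] conjI; (elim conjE)?)
    fix k assume k: "k \<in> Arr (slice X x)" "Dom (slice X x) k = u" "Cod (slice X x) k = Ide X x"
    then obtain h where h: "k = (u, h, Ide X x)"
      by (cases k) (auto simp: slice_simps)
    with k(1) have "h \<in> Arr X" "Cod X h = x" "u = Comp X (Ide X x) h"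
      using x by (auto simp: slice_Arr X.Dom_Ide X.Cod_Ide)
    with h show "k = (u, u, Ide X x)" by (simp add: X_simps)
  qed (use x u in \<open>simp_all add: slice_simps slice_Arr X_simps\<close>)
  then show ?thesis using x
    by (simp add: terminal_in_def slice_simps X_simps)
qed

text \<open>The identity is initial in the coslice, and reversing arrows makes it terminal.\<close>

lemma terminal_in_op_coslice:
  assumes x: "x \<in> Obj X"
  shows "terminal_in (op_cat (coslice X x)) (Ide X x)"
proof -
  have "\<exists>!k. k \<in> Arr (coslice X x) \<and> Cod (coslice X x) k = u \<and> Dom (coslice X x) k = Ide X x"
    if u: "u \<in> Obj (coslice X x)" for u
  proof (intro ex1I[of _ "(Ide X x, u, u)"] conjI; (elim conjE)?)
    fix k assume k: "k \<in> Arr (coslice X x)" "Cod (coslice X x) k = u" "Dom (coslice X x) k = Ide X x"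
    then obtain h where h: "k = (Ide X x, h, u)"
      by (cases k) (auto simp: coslice_simps)
    with k(1) have "h \<in> Arr X" "Dom X h = x" "u = Comp X h (Ide X x)"
      using x by (auto simp: coslice_Arr X.Dom_Ide X.Cod_Ide)
    with h show "k = (Ide X x, u, u)" by (simp add: X_simps)
  qed (use x u in \<open>simp_all add: coslice_simps coslice_Arr X_simps\<close>)
  then show ?thesis using x
    by (simp add: terminal_in_def coslice_simps X_simps)
qed

text \<open>By associativity, composing with \<open>f\<close> preserves commuting triangles; the
  middle component, which is the projection, stays unchanged.\<close>

lemma slice_map_over_hom:
  assumes "f \<in> Arr X"
  shows "slice_map X f \<in> over_hom (slice X (Dom X f)) (slice X (Cod X f))"
proof (rule over_homI)
  interpret D: is_functor "slice X (Dom X f)" X "prO (slice X (Dom X f))" "prA (slice X (Dom X f))"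
    by (rule slice_is_functor)
  interpret C: is_functor "slice X (Cod X f)" X "prO (slice X (Cod X f))" "prA (slice X (Cod X f))"
    by (rule slice_is_functor)
  show "is_functor (slice X (Dom X f)) (slice X (Cod X f)) (fst (slice_map X f)) (snd (slice_map X f))"
    using assms
    by unfold_locales
      (auto simp: slice_map_def slice_simps slice_Arr X_simps X.Comp_assoc split_paired_all)
qed (use assms in \<open>auto simp: slice_map_def slice_simps slice_Arr X_simps\<close>)

lemma coslice_map_over_hom:
  assumes "f \<in> Arr X"
  shows "coslice_map X f \<in> over_hom (coslice X (Cod X f)) (coslice X (Dom X f))"
proof (rule over_homI)
  interpret D: is_functor "coslice X (Dom X f)" X "prO (coslice X (Dom X f))" "prA (coslice X (Dom X f))"
    by (rule coslice_is_functor)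
  interpret C: is_functor "coslice X (Cod X f)" X "prO (coslice X (Cod X f))" "prA (coslice X (Cod X f))"
    by (rule coslice_is_functor)
  show "is_functor (coslice X (Cod X f)) (coslice X (Dom X f)) (fst (coslice_map X f)) (snd (coslice_map X f))"
    using assms
    by unfold_locales
      (auto simp: coslice_map_def coslice_simps coslice_Arr X_simps X.Comp_assoc split_paired_all)
qed (use assms in \<open>auto simp: coslice_map_def coslice_simps coslice_Arr X_simps\<close>)

section \<open>Fibers of the two coreflections\<close>

lemma fib_coreflection_fibers_slice:
  assumes "fib_coreflection TYPE('y) TYPE('y \<times> 'y \<times> 'y) X P C e"
  shows "\<exists>\<phi>. (\<forall>x\<in>Obj X. bij_betw (\<phi> x) (fiber C x) (over_hom (slice X x) P)) \<and>
              (\<forall>l\<in>Arr C. \<phi> (prO C (Dom C l)) (Dom C l) =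
                 fmap_comp (slice X (prO C (Dom C l)))
                   (\<phi> (prO C (Cod C l)) (Cod C l)) (slice_map X (prA C l)))"
proof (rule fib_coreflection_fibers[OF assms, where t = "Ide X"])
  fix f assume "f \<in> Arr X"
  \<comment> \<open>\<open>slice_map X f\<close> takes the identity of \<open>Dom X f\<close> to
    \<open>f\<close>, and the arrow from \<open>f\<close> to the terminal object of the slice lies
    over \<open>f\<close>.\<close>
  then show "\<exists>k\<in>Arr (slice X (Cod X f)).
      Dom (slice X (Cod X f)) k = fst (slice_map X f) (Ide X (Dom X f)) \<and>
      Cod (slice X (Cod X f)) k = Ide X (Cod X f) \<and> prA (slice X (Cod X f)) k = f"
    by (intro bexI[of _ "(f, f, Ide X (Cod X f))"])
      (auto simp: slice_simps slice_Arr slice_map_def X_simps)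
qed (simp_all add: discrete_fibration_slice terminal_in_slice slice_map_over_hom,
    simp add: slice_simps X_simps)

lemma opfib_coreflection_fibers_coslice:
  assumes "opfib_coreflection TYPE('y) TYPE('y \<times> 'y \<times> 'y) X P D d"
  shows "\<exists>\<psi>. (\<forall>x\<in>Obj X. bij_betw (\<psi> x) (fiber D x) (over_hom (coslice X x) P)) \<and>
              (\<forall>l\<in>Arr D. \<psi> (prO D (Cod D l)) (Cod D l) =
                 fmap_comp (coslice X (prO D (Cod D l)))
                   (\<psi> (prO D (Dom D l)) (Dom D l)) (coslice_map X (prA D l)))"
proof -
  have "\<exists>k\<in>Arr (coslice X (Dom X f)).
      Cod (coslice X (Dom X f)) k = fst (coslice_map X f) (Ide X (Cod X f)) \<and>
      Dom (coslice X (Dom X f)) k = Ide X (Dom X f) \<and> prA (coslice X (Dom X f)) k = f"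
    if "f \<in> Arr X" for f
    using that by (intro bexI[of _ "(Ide X (Dom X f), f, f)"])
      (auto simp: coslice_simps coslice_Arr coslice_map_def X_simps)
  moreover have "prO (coslice X x) (Ide X x) = x" if "x \<in> Obj X" for x
    using that by (simp add: coslice_simps X_simps)
  \<comment> \<open>In \<open>op_cat X\<close> the arrow \<open>f\<close> runs from
    \<open>Cod X f\<close> to \<open>Dom X f\<close>, so \<open>coslice_map X f\<close> points in
    the direction required of \<open>m f\<close>. The simplification rules for \<open>op_cat\<close>
    then remove the opposites.\<close>
  ultimately show ?thesis
    using fib_coreflection_fibers[OF fib_coreflection_op_cat[OF assms],
        where S = "\<lambda>x. op_cat (coslice X x)" and t = "Ide X" and m = "coslice_map X"]
    by (simp add: discrete_opfibration_coslice terminal_in_op_coslice coslice_map_over_hom)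
qed

end

text \<open>The second half of each conjunct is naturality in \<open>x\<close>: an arrow
  \<open>l\<close> of \<open>C\<close> exhibits its domain as the restriction of its codomain along
  \<open>prA C l\<close>, which has to match precomposition with \<open>slice_map\<close>; dually
  for \<open>D\<close>.\<close>

theorem proposition18:
  fixes X :: "('x, 'y) cat"
    and P :: "('o, 'a, 'x, 'y) cat_over"
    and C :: "('c, 'd, 'x, 'y) cat_over" and e :: "('c, 'd, 'o, 'a) fmap"
    and D :: "('g, 'h, 'x, 'y) cat_over" and d :: "('g, 'h, 'o, 'a) fmap"
  assumes "category X" and "category_over X P"
    and "fib_coreflection TYPE('y) TYPE('y \<times> 'y \<times> 'y) X P C e"
    and "opfib_coreflection TYPE('y) TYPE('y \<times> 'y \<times> 'y) X P D d"
  shows "(\<exists>\<phi>. (\<forall>x\<in>Obj X. bij_betw (\<phi> x) (fiber C x) (over_hom (slice X x) P)) \<and>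
              (\<forall>l\<in>Arr C. \<phi> (prO C (Dom C l)) (Dom C l) =
                 fmap_comp (slice X (prO C (Dom C l)))
                   (\<phi> (prO C (Cod C l)) (Cod C l)) (slice_map X (prA C l)))) \<and>
         (\<exists>\<psi>. (\<forall>x\<in>Obj X. bij_betw (\<psi> x) (fiber D x) (over_hom (coslice X x) P)) \<and>
              (\<forall>l\<in>Arr D. \<psi> (prO D (Cod D l)) (Cod D l) =
                 fmap_comp (coslice X (prO D (Cod D l)))
                   (\<psi> (prO D (Dom D l)) (Dom D l)) (coslice_map X (prA D l))))"
  using assms fib_coreflection_fibers_slice opfib_coreflection_fibers_coslice by (intro conjI) blast+

end
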